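(* Let $\sigma\in\{1,-1\}$ and let $U$ be an open subset of the Weyl upper half-plane. Let $\natural$ be an involutive map on $n\times n$ matrix functions on $U$ (applied coefficientwise to matrix-valued one-forms) such that $(N_1N_2)^\natural=N_2^\natural N_1^\natural$, $(N_1+N_2)^\natural=N_1^\natural+N_2^\natural$, $(fN)^\natural=f^\natural N^\natural$ for scalar functions $f$, where $f\mapsto f^\natural$ is either the identity or complex conjugation, $\partial_\rho(N^\natural)=(\partial_\rho N)^\natural$, $\partial_v(N^\natural)=(\partial_vN)^\natural$, and $\natural$ commutes with $\star$. Let $V$ be an invertible $n\times n$ matrix function on $U$ of class $C^2$, set $M=V^\natural V$ and $A=M^{-1}dM$. Let $\varphi,\chi:U\to\mathbb{C}$ be $C^\infty$ functions, each of the form $\frac{-\sigma(\omega-v)\pm\sqrt{(\omega-v)^2+\sigma\rho^2}}{\rho}$ for some $\omega\in\mathbb{C}$ and a continuous branch of the square root, with $\varphi,\chi\ne0$ and $\varphi^2+\sigma,\chi^2+\sigma\neq0$ on $U$, and with $\chi=-\sigma/\varphi^\natural$. Let $X$ and $\widetilde X$ be invertible $n\times n$ matrix functions on $U$ of class $C^2$ (with $C^1$ inverses) solving $$\varphi\,(dX+AX)=\star dX,\qquad \chi\,(d\widetilde X+A\widetilde X)=\star d\widetilde X.$$ Then the matrix function $\mathcal{M}=\widetilde X^\natural\,M\,X$ satisfies $d\mathcal{M}=0$ on $U$.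
   Context: The Weyl upper half-plane is $\{(\rho,v)\in\mathbb{R}^2:\rho>0\}$. The Hodge star $\star$ acts on one-forms in $(\rho,v)$ (entrywise, linearly over functions) by $\star d\rho=-\sigma\,dv$, $\star dv=d\rho$. Examples of $\natural$: $N^\natural=N^T$, or $N^\natural=\eta N^\dagger\eta^{-1}$ for a constant invertible matrix $\eta$. *)

theory Defs
  imports "HOL-Analysis.Analysis"
begin

text \<open>Points of the Weyl upper half-plane are pairs (rho, v) :: real \<times> real.
  A (matrix-valued) one-form P d rho + Q dv is represented, pointwise, by the
  pair of coefficients (P, Q).\<close>

definition has_pd_rho :: "(real \<times> real \<Rightarrow> 'a::real_normed_vector) \<Rightarrow> 'a \<Rightarrow> real \<times> real \<Rightarrow> bool" where
  "has_pd_rho f D p \<longleftrightarrow> ((\<lambda>t. f (t, snd p)) has_vector_derivative D) (at (fst p))"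

definition has_pd_v :: "(real \<times> real \<Rightarrow> 'a::real_normed_vector) \<Rightarrow> 'a \<Rightarrow> real \<times> real \<Rightarrow> bool" where
  "has_pd_v f D p \<longleftrightarrow> ((\<lambda>t. f (fst p, t)) has_vector_derivative D) (at (snd p))"

definition pd_rho :: "(real \<times> real \<Rightarrow> 'a::real_normed_vector) \<Rightarrow> real \<times> real \<Rightarrow> 'a" where
  "pd_rho f p = vector_derivative (\<lambda>t. f (t, snd p)) (at (fst p))"

definition pd_v :: "(real \<times> real \<Rightarrow> 'a::real_normed_vector) \<Rightarrow> real \<times> real \<Rightarrow> 'a" where
  "pd_v f p = vector_derivative (\<lambda>t. f (fst p, t)) (at (snd p))"

text \<open>Iterated partial derivatives: True = d/d rho, False = d/dv.\<close>
fun iter_pd :: "bool list \<Rightarrow> (real \<times> real \<Rightarrow> 'a::real_normed_vector) \<Rightarrow> real \<times> real \<Rightarrow> 'a" where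
  "iter_pd [] f = f"
| "iter_pd (b # bs) f = (if b then pd_rho (iter_pd bs f) else pd_v (iter_pd bs f))"

text \<open>Class C^k on an open set U: all partial derivatives of order \<le> k exist on U
  and are continuous on U.\<close>
definition Ck_on :: "nat \<Rightarrow> (real \<times> real) set \<Rightarrow> (real \<times> real \<Rightarrow> 'a::real_normed_vector) \<Rightarrow> bool" where
  "Ck_on k U f \<longleftrightarrow> (\<forall>bs. length bs \<le> k \<longrightarrow>
      continuous_on U (iter_pd bs f) \<and>
      (length bs < k \<longrightarrow> (\<forall>p\<in>U. (\<exists>D. has_pd_rho (iter_pd bs f) D p) \<and> (\<exists>D. has_pd_v (iter_pd bs f) D p))))"

definition smooth_on :: "(real \<times> real) set \<Rightarrow> (real \<times> real \<Rightarrow> 'a::real_normed_vector) \<Rightarrow> bool" where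
  "smooth_on U f \<longleftrightarrow> (\<forall>k. Ck_on k U f)"

text \<open>Exterior derivative of a function, as a one-form (coefficients of d rho, dv).\<close>
definition dform :: "(real \<times> real \<Rightarrow> 'a::real_normed_vector) \<Rightarrow> real \<times> real \<Rightarrow> 'a \<times> 'a" where
  "dform f p = (pd_rho f p, pd_v f p)"

text \<open>Hodge star: star d rho = - sigma dv, star dv = d rho.
  So star (P d rho + Q dv) = Q d rho - sigma P dv.\<close>
definition hstar :: "real \<Rightarrow> 'a::real_vector \<times> 'a \<Rightarrow> 'a \<times> 'a" where
  "hstar \<sigma> w = (snd w, (- \<sigma>) *\<^sub>R fst w)"

text \<open>Scalar (complex) multiple of a matrix.\<close>
definition cscale :: "complex \<Rightarrow> complex^'n^'n \<Rightarrow> complex^'n^'n" where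
  "cscale c N = (\<chi> i j. c * N $ i $ j)"

text \<open>Applying the involution coefficientwise to a matrix-valued one-form.\<close>
definition form_nat :: "((real \<times> real \<Rightarrow> complex^'n^'n) \<Rightarrow> (real \<times> real \<Rightarrow> complex^'n^'n))
    \<Rightarrow> (real \<times> real \<Rightarrow> (complex^'n^'n) \<times> (complex^'n^'n)) \<Rightarrow> real \<times> real \<Rightarrow> (complex^'n^'n) \<times> (complex^'n^'n)" where
  "form_nat nt \<omega> p = (nt (\<lambda>q. fst (\<omega> q)) p, nt (\<lambda>q. snd (\<omega> q)) p)"

text \<open>Conditions on the involution nt (with scalar part sc) on matrix functions on U.\<close>
definition natural_inv :: "(real \<times> real) set \<Rightarrow> real \<Rightarrow> (complex \<Rightarrow> complex)
    \<Rightarrow> ((real \<times> real \<Rightarrow> complex^'n^'n) \<Rightarrow> (real \<times> real \<Rightarrow> complex^'n^'n)) \<Rightarrow> bool" where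
  "natural_inv U \<sigma> sc nt \<longleftrightarrow>
     (sc = id \<or> sc = cnj) \<and>
     \<comment> \<open>a map on functions on U (only values on U matter)\<close>
     (\<forall>N1 N2. (\<forall>p\<in>U. N1 p = N2 p) \<longrightarrow> (\<forall>p\<in>U. nt N1 p = nt N2 p)) \<and>
     (\<forall>N. \<forall>p\<in>U. nt (nt N) p = N p) \<and>
     (\<forall>N1 N2. \<forall>p\<in>U. nt (\<lambda>q. N1 q ** N2 q) p = nt N2 p ** nt N1 p) \<and>
     (\<forall>N1 N2. \<forall>p\<in>U. nt (\<lambda>q. N1 q + N2 q) p = nt N1 p + nt N2 p) \<and>
     (\<forall>f N. \<forall>p\<in>U. nt (\<lambda>q. cscale (f q) (N q)) p = cscale (sc (f p)) (nt N p)) \<and>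
     (\<forall>N. (\<forall>p\<in>U. \<exists>D. has_pd_rho N D p) \<longrightarrow> (\<forall>p\<in>U. has_pd_rho (nt N) (nt (pd_rho N) p) p)) \<and>
     (\<forall>N. (\<forall>p\<in>U. \<exists>D. has_pd_v N D p) \<longrightarrow> (\<forall>p\<in>U. has_pd_v (nt N) (nt (pd_v N) p) p)) \<and>
     (\<forall>\<omega>. \<forall>p\<in>U. form_nat nt (\<lambda>q. hstar \<sigma> (\<omega> q)) p = hstar \<sigma> (form_nat nt \<omega> p))"

text \<open>phi = (- sigma (w - v) + s)/rho with s a continuous branch of
  sqrt((w - v)^2 + sigma rho^2) on U (the sign +- is absorbed into the branch).\<close>
definition sqrt_branch_form :: "(real \<times> real) set \<Rightarrow> real \<Rightarrow> (real \<times> real \<Rightarrow> complex) \<Rightarrow> bool" where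
  "sqrt_branch_form U \<sigma> \<phi> \<longleftrightarrow> (\<exists>\<omega>::complex. \<exists>s. continuous_on U s \<and>
      (\<forall>p\<in>U. (s p)\<^sup>2 = (\<omega> - of_real (snd p))\<^sup>2 + of_real \<sigma> * (of_real (fst p))\<^sup>2 \<and>
              \<phi> p = (- of_real \<sigma> * (\<omega> - of_real (snd p)) + s p) / of_real (fst p)))"

end

theory Submission
  imports Defs
begin

text \<open>Differentiate \<open>Xt\<^sup>\<natural> M X\<close> in two ways. Multiplied by \<open>M\<close>, the equation
  \<open>\<phi> (dX + A X) = \<star>dX\<close> becomes \<open>\<phi> d(M X) = \<star>(M dX)\<close>; grouping the product as
  \<open>Xt\<^sup>\<natural> (M X)\<close> this gives one expression for its differential. Grouping it as
  \<open>(M Xt)\<^sup>\<natural> X\<close> instead and applying \<open>\<natural>\<close> to the equation of \<open>Xt\<close>, whose scalar \<open>\<chi>\<close>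
  becomes \<open>\<chi>\<^sup>\<natural> = -\<sigma>/\<phi>\<close>, gives a second one. Comparing the two shows that the
  differential \<open>\<omega>\<close> of the product satisfies \<open>\<phi> \<omega> = \<star>\<omega>\<close>, and since \<open>\<star>\<star> = -\<sigma>\<close> this
  forces \<open>(\<phi>\<^sup>2 + \<sigma>) \<omega> = 0\<close>.\<close>

lemma bounded_bilinear_matrix_matrix_mult:
  "bounded_bilinear ((**) :: 'a::{euclidean_space,real_algebra_1}^'n::finite^'m::finite
      \<Rightarrow> 'a^'k::finite^'n \<Rightarrow> 'a^'k^'m)"
proof -
  have "bilinear ((**) :: 'a^'n^'m \<Rightarrow> 'a^'k^'n \<Rightarrow> 'a^'k^'m)"
    unfolding bilinear_def
    by (auto intro!: linearI simp: matrix_add_ldistrib vec_eq_iff matrix_matrix_mult_def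
        sum.distrib distrib_left distrib_right scaleR_sum_right)
  then show ?thesis
    by (rule bilinear_conv_bounded_bilinear[THEN iffD1])
qed

lemma has_pd_rho_mult:
  fixes f :: "real \<times> real \<Rightarrow> 'a::{euclidean_space,real_algebra_1}^'n::finite^'m::finite"
    and g :: "real \<times> real \<Rightarrow> 'a^'k::finite^'n"
  assumes "has_pd_rho f Df p" "has_pd_rho g Dg p"
  shows "has_pd_rho (\<lambda>q. f q ** g q) (f p ** Dg + Df ** g p) p"
  using bounded_bilinear.has_vector_derivative[OF bounded_bilinear_matrix_matrix_mult
      assms[unfolded has_pd_rho_def]]
  by (simp add: has_pd_rho_def)

lemma has_pd_v_mult:
  fixes f :: "real \<times> real \<Rightarrow> 'a::{euclidean_space,real_algebra_1}^'n::finite^'m::finite"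
    and g :: "real \<times> real \<Rightarrow> 'a^'k::finite^'n"
  assumes "has_pd_v f Df p" "has_pd_v g Dg p"
  shows "has_pd_v (\<lambda>q. f q ** g q) (f p ** Dg + Df ** g p) p"
  using bounded_bilinear.has_vector_derivative[OF bounded_bilinear_matrix_matrix_mult
      assms[unfolded has_pd_v_def]]
  by (simp add: has_pd_v_def)

lemma has_pd_rho_transform_within_open:
  assumes "has_pd_rho f D p" "open U" "p \<in> U" "\<And>q. q \<in> U \<Longrightarrow> f q = g q"
  shows "has_pd_rho g D p"
proof -
  have "open ((\<lambda>t. (t, snd p)) -` U)"
    using \<open>open U\<close> by (intro continuous_open_vimage continuous_intros)
  with assms show ?thesis
    unfolding has_pd_rho_def by (auto intro: has_vector_derivative_transform_within_open)
qed

lemma has_pd_v_transform_within_open: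
  assumes "has_pd_v f D p" "open U" "p \<in> U" "\<And>q. q \<in> U \<Longrightarrow> f q = g q"
  shows "has_pd_v g D p"
proof -
  have "open ((\<lambda>t. (fst p, t)) -` U)"
    using \<open>open U\<close> by (intro continuous_open_vimage continuous_intros)
  with assms show ?thesis
    unfolding has_pd_v_def by (auto intro: has_vector_derivative_transform_within_open)
qed

lemma has_pd_rho_imp_pd_rho: "has_pd_rho f D p \<Longrightarrow> pd_rho f p = D"
  by (simp add: has_pd_rho_def pd_rho_def vector_derivative_at)

lemma has_pd_v_imp_pd_v: "has_pd_v f D p \<Longrightarrow> pd_v f p = D"
  by (simp add: has_pd_v_def pd_v_def vector_derivative_at)

lemma has_pd_rho_pd_rho: "has_pd_rho f D p \<Longrightarrow> has_pd_rho f (pd_rho f p) p"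
  by (simp add: has_pd_rho_imp_pd_rho)

lemma has_pd_v_pd_v: "has_pd_v f D p \<Longrightarrow> has_pd_v f (pd_v f p) p"
  by (simp add: has_pd_v_imp_pd_v)

lemma Ck_on_has_pd:
  assumes "Ck_on k U f" "0 < k" "p \<in> U"
  shows "has_pd_rho f (pd_rho f p) p" "has_pd_v f (pd_v f p) p"
proof -
  from assms(1)[unfolded Ck_on_def, rule_format, of "[]"] assms(2,3)
  obtain D D' where "has_pd_rho f D p" "has_pd_v f D' p"
    by auto
  then show "has_pd_rho f (pd_rho f p) p" "has_pd_v f (pd_v f p) p"
    by (simp_all add: has_pd_rho_pd_rho has_pd_v_pd_v)
qed

lemma matrix_inv_right:
  fixes A :: "'a::field^'n::finite^'n"
  shows "invertible A \<Longrightarrow> A ** matrix_inv A = mat 1"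
  unfolding invertible_def matrix_inv_def by (rule someI2_ex) auto

lemma matrix_mult_cscale_right: "A ** cscale c B = cscale c (A ** B)"
  by (simp add: cscale_def matrix_matrix_mult_def vec_eq_iff sum_distrib_left mult.left_commute)

lemma matrix_mult_cscale_left: "cscale c A ** B = cscale c (A ** B)"
  by (simp add: cscale_def matrix_matrix_mult_def vec_eq_iff sum_distrib_left mult.assoc)

lemma cscale_cscale: "cscale a (cscale b N) = cscale (a * b) N"
  by (simp add: cscale_def vec_eq_iff mult.assoc)

lemma cscale_add: "cscale c (A + B) = cscale c A + cscale c B"
  by (simp add: cscale_def vec_eq_iff distrib_left)

lemma cscale_eq_0_iff: "cscale c N = 0 \<longleftrightarrow> c = 0 \<or> N = 0"
  by (auto simp: cscale_def vec_eq_iff)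

lemma cscale_eq_iff: "c \<noteq> 0 \<Longrightarrow> cscale c N = P \<longleftrightarrow> N = cscale (inverse c) P"
  by (auto simp: cscale_def vec_eq_iff field_simps)

lemma scaleR_eq_cscale: "r *\<^sub>R (N :: complex^'n^'n) = cscale (of_real r) N"
  by (simp add: cscale_def vec_eq_iff) (simp add: scaleR_conv_of_real)

lemma hstar_eigenform_eq_0:
  assumes "(cscale f R, cscale f S) = hstar \<sigma> (R, S)" "f\<^sup>2 + of_real \<sigma> \<noteq> 0"
  shows "R = 0" "S = 0"
proof -
  from assms(1) have S: "S = cscale f R" and R: "cscale f S = cscale (- of_real \<sigma>) R"
    by (simp_all add: hstar_def scaleR_eq_cscale)
  have "cscale (f\<^sup>2 + of_real \<sigma>) R = cscale f S - cscale (- of_real \<sigma>) R"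
    by (simp add: S cscale_cscale cscale_def vec_eq_iff power2_eq_square algebra_simps)
  with R assms(2) show "R = 0"
    by (simp add: cscale_eq_0_iff)
  with S show "S = 0"
    by (simp add: cscale_def vec_eq_iff)
qed

context
  fixes U :: "(real \<times> real) set" and \<sigma> :: real and sc :: "complex \<Rightarrow> complex"
    and nt :: "(real \<times> real \<Rightarrow> complex^'n::finite^'n) \<Rightarrow> real \<times> real \<Rightarrow> complex^'n^'n"
  assumes nt: "natural_inv U \<sigma> sc nt"
begin

lemma natural_inv_scalar: "sc = id \<or> sc = cnj"
  using nt by (simp add: natural_inv_def)

lemma natural_inv_cong: "(\<And>q. q \<in> U \<Longrightarrow> N1 q = N2 q) \<Longrightarrow> p \<in> U \<Longrightarrow> nt N1 p = nt N2 p"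
  using nt by (simp add: natural_inv_def)

lemma natural_inv_involutive: "p \<in> U \<Longrightarrow> nt (nt N) p = N p"
  using nt by (simp add: natural_inv_def)

lemma natural_inv_mult: "p \<in> U \<Longrightarrow> nt (\<lambda>q. N1 q ** N2 q) p = nt N2 p ** nt N1 p"
  using nt by (simp add: natural_inv_def)

lemma natural_inv_cscale: "p \<in> U \<Longrightarrow> nt (\<lambda>q. cscale (f q) (N q)) p = cscale (sc (f p)) (nt N p)"
  using nt by (simp add: natural_inv_def)

lemma natural_inv_cscale_eq:
  "(\<And>q. q \<in> U \<Longrightarrow> cscale (c q) (D q) = N q) \<Longrightarrow> p \<in> U \<Longrightarrow> cscale (sc (c p)) (nt D p) = nt N p"
  using natural_inv_cscale[of p c D] natural_inv_cong[of "\<lambda>q. cscale (c q) (D q)" N p] by simp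

lemma natural_inv_has_pd_rho:
  assumes "\<And>q. q \<in> U \<Longrightarrow> has_pd_rho N (pd_rho N q) q" "p \<in> U"
  shows "has_pd_rho (nt N) (nt (pd_rho N) p) p"
proof -
  have "\<forall>N. (\<forall>p\<in>U. \<exists>D. has_pd_rho N D p) \<longrightarrow> (\<forall>p\<in>U. has_pd_rho (nt N) (nt (pd_rho N) p) p)"
    using nt by (simp add: natural_inv_def)
  with assms show ?thesis
    by blast
qed

lemma natural_inv_has_pd_v:
  assumes "\<And>q. q \<in> U \<Longrightarrow> has_pd_v N (pd_v N q) q" "p \<in> U"
  shows "has_pd_v (nt N) (nt (pd_v N) p) p"
proof -
  have "\<forall>N. (\<forall>p\<in>U. \<exists>D. has_pd_v N D p) \<longrightarrow> (\<forall>p\<in>U. has_pd_v (nt N) (nt (pd_v N) p) p)"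
    using nt by (simp add: natural_inv_def)
  with assms show ?thesis
    by blast
qed

lemma natural_inv_mat_1: "p \<in> U \<Longrightarrow> nt (\<lambda>_. mat 1) p = mat 1"
  using natural_inv_mult[of p "\<lambda>_. mat 1" "nt (\<lambda>_. mat 1)"] natural_inv_involutive[of p]
  by simp

lemma natural_inv_invertible:
  assumes "\<And>q. q \<in> U \<Longrightarrow> invertible (N q)" "p \<in> U"
  shows "invertible (nt N p)"
proof -
  have "nt (\<lambda>q. matrix_inv (N q)) p ** nt N p = nt (\<lambda>q. N q ** matrix_inv (N q)) p"
    using natural_inv_mult[OF \<open>p \<in> U\<close>] by simp
  also have "\<dots> = nt (\<lambda>_. mat 1) p"
    using assms by (intro natural_inv_cong) (simp_all add: matrix_inv_right)
  also have "\<dots> = mat 1"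
    using natural_inv_mat_1 \<open>p \<in> U\<close> .
  finally show ?thesis
    by (auto simp: invertible_left_inverse)
qed

lemma natural_inv_mult_self: "p \<in> U \<Longrightarrow> nt (\<lambda>q. nt N q ** N q) p = nt N p ** N p"
  using natural_inv_mult natural_inv_involutive by simp

lemma natural_inv_has_pd_rho_mult:
  assumes "\<And>q. q \<in> U \<Longrightarrow> has_pd_rho F (pd_rho F q) q" "has_pd_rho G D p" "p \<in> U"
  shows "has_pd_rho (\<lambda>q. nt F q ** G q) (nt F p ** D + nt (pd_rho F) p ** G p) p"
  using assms by (intro has_pd_rho_mult natural_inv_has_pd_rho)

lemma natural_inv_has_pd_v_mult:
  assumes "\<And>q. q \<in> U \<Longrightarrow> has_pd_v F (pd_v F q) q" "has_pd_v G D p" "p \<in> U"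
  shows "has_pd_v (\<lambda>q. nt F q ** G q) (nt F p ** D + nt (pd_v F) p ** G p) p"
  using assms by (intro has_pd_v_mult natural_inv_has_pd_v)

end

text \<open>\<open>M\<close> plays the role of \<open>V\<^sup>\<natural> V\<close>; only its \<open>\<natural>\<close>-symmetry, invertibility and
  first partial derivatives are used.\<close>

locale natural_connection =
  fixes U :: "(real \<times> real) set" and \<sigma> :: real and sc :: "complex \<Rightarrow> complex"
    and nt :: "(real \<times> real \<Rightarrow> complex^'n::finite^'n) \<Rightarrow> real \<times> real \<Rightarrow> complex^'n^'n"
    and M :: "real \<times> real \<Rightarrow> complex^'n^'n"
    and A :: "real \<times> real \<Rightarrow> (complex^'n^'n) \<times> (complex^'n^'n)"
  assumes open_U: "open U"
    and sigma: "\<sigma> \<in> {1, -1}"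
    and natural: "natural_inv U \<sigma> sc nt"
    and invertible_M: "\<And>q. q \<in> U \<Longrightarrow> invertible (M q)"
    and natural_M: "\<And>q. q \<in> U \<Longrightarrow> nt M q = M q"
    and has_pd_rho_M: "\<And>q. q \<in> U \<Longrightarrow> has_pd_rho M (pd_rho M q) q"
    and has_pd_v_M: "\<And>q. q \<in> U \<Longrightarrow> has_pd_v M (pd_v M q) q"
    and A_def: "A = (\<lambda>q. (matrix_inv (M q) ** pd_rho M q, matrix_inv (M q) ** pd_v M q))"
begin

definition solves :: "(real \<times> real \<Rightarrow> complex) \<Rightarrow> (real \<times> real \<Rightarrow> complex^'n^'n) \<Rightarrow> bool" where
  "solves f Y \<longleftrightarrow> (\<forall>q\<in>U. has_pd_rho Y (pd_rho Y q) q \<and> has_pd_v Y (pd_v Y q) q \<and>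
      (cscale (f q) (fst (dform Y q) + fst (A q) ** Y q),
       cscale (f q) (snd (dform Y q) + snd (A q) ** Y q)) = hstar \<sigma> (dform Y q))"

lemma solves_M_mult:
  assumes "solves f Y" "q \<in> U"
  shows "has_pd_rho (\<lambda>q. M q ** Y q) (M q ** pd_rho Y q + pd_rho M q ** Y q) q"
    and "has_pd_v (\<lambda>q. M q ** Y q) (M q ** pd_v Y q + pd_v M q ** Y q) q"
    and "cscale (f q) (M q ** pd_rho Y q + pd_rho M q ** Y q) = M q ** pd_v Y q"
    and "cscale (f q) (M q ** pd_v Y q + pd_v M q ** Y q) = cscale (- of_real \<sigma>) (M q ** pd_rho Y q)"
proof -
  from assms[unfolded solves_def] have Y: "has_pd_rho Y (pd_rho Y q) q" "has_pd_v Y (pd_v Y q) q"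
    and sys: "cscale (f q) (pd_rho Y q + (matrix_inv (M q) ** pd_rho M q) ** Y q) = pd_v Y q"
      "cscale (f q) (pd_v Y q + (matrix_inv (M q) ** pd_v M q) ** Y q) = cscale (- of_real \<sigma>) (pd_rho Y q)"
    by (auto simp: A_def dform_def hstar_def scaleR_eq_cscale)
  show "has_pd_rho (\<lambda>q. M q ** Y q) (M q ** pd_rho Y q + pd_rho M q ** Y q) q"
    "has_pd_v (\<lambda>q. M q ** Y q) (M q ** pd_v Y q + pd_v M q ** Y q) q"
    using has_pd_rho_mult[OF has_pd_rho_M Y(1)] has_pd_v_mult[OF has_pd_v_M Y(2)] \<open>q \<in> U\<close> by auto
  have M_inv: "M q ** (matrix_inv (M q) ** N) = N" for N
    using matrix_inv_right[OF invertible_M[OF \<open>q \<in> U\<close>]] by (simp add: matrix_mul_assoc)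
  show "cscale (f q) (M q ** pd_rho Y q + pd_rho M q ** Y q) = M q ** pd_v Y q"
    "cscale (f q) (M q ** pd_v Y q + pd_v M q ** Y q) = cscale (- of_real \<sigma>) (M q ** pd_rho Y q)"
    using arg_cong[OF sys(1), of "(**) (M q)"] arg_cong[OF sys(2), of "(**) (M q)"]
    by (simp_all add: matrix_mult_cscale_right matrix_add_ldistrib matrix_mul_assoc[symmetric] M_inv)
qed

lemma solves_natural_mult_M_has_pd:
  assumes "solves chi Y" "p \<in> U" "f \<noteq> 0" "chi p = - of_real \<sigma> / sc f"
  shows "has_pd_rho (\<lambda>q. nt Y q ** M q) (cscale (- of_real \<sigma> * f) (nt (pd_v Y) p ** M p)) p"
    and "has_pd_v (\<lambda>q. nt Y q ** M q) (cscale f (nt (pd_rho Y) p ** M p)) p"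
proof -
  define W where "W = (\<lambda>q. M q ** Y q)"
  have nt_W: "nt W q = nt Y q ** M q" if "q \<in> U" for q
    using that by (simp add: W_def natural_inv_mult[OF natural] natural_M)
  have pd_W: "pd_rho W q = M q ** pd_rho Y q + pd_rho M q ** Y q"
      "pd_v W q = M q ** pd_v Y q + pd_v M q ** Y q" if "q \<in> U" for q
    using solves_M_mult(1,2)[OF \<open>solves chi Y\<close> that] unfolding W_def
    by (simp_all add: has_pd_rho_imp_pd_rho has_pd_v_imp_pd_v)
  have W: "has_pd_rho W (pd_rho W q) q" "has_pd_v W (pd_v W q) q"
    and sys_W: "cscale (chi q) (pd_rho W q) = M q ** pd_v Y q"
      "cscale (chi q) (pd_v W q) = cscale (- of_real \<sigma>) (M q ** pd_rho Y q)"
    if "q \<in> U" for q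
    using solves_M_mult[OF \<open>solves chi Y\<close> that] pd_W[OF that] by (simp_all add: W_def)
  have sc_chi: "sc (chi p) = - of_real \<sigma> / f" and chi_nz: "sc (chi p) \<noteq> 0"
    using natural_inv_scalar[OF natural] \<open>chi p = _\<close> \<open>f \<noteq> 0\<close> sigma by auto
  have inverse_sc_chi: "inverse (sc (chi p)) = - of_real \<sigma> * f"
    unfolding sc_chi using sigma \<open>f \<noteq> 0\<close> by auto
  have "cscale (sc (chi p)) (nt (pd_rho W) p) = nt (\<lambda>q. M q ** pd_v Y q) p"
    using sys_W(1) \<open>p \<in> U\<close> by (rule natural_inv_cscale_eq[OF natural])
  also have "\<dots> = nt (pd_v Y) p ** M p"
    using natural_inv_mult[OF natural \<open>p \<in> U\<close>] natural_M[OF \<open>p \<in> U\<close>] by simp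
  finally have rho: "nt (pd_rho W) p = cscale (- of_real \<sigma> * f) (nt (pd_v Y) p ** M p)"
    by (simp add: cscale_eq_iff[OF chi_nz] inverse_sc_chi)
  have "cscale (sc (chi p)) (nt (pd_v W) p) = nt (\<lambda>q. cscale (- of_real \<sigma>) (M q ** pd_rho Y q)) p"
    using sys_W(2) \<open>p \<in> U\<close> by (rule natural_inv_cscale_eq[OF natural])
  also have "\<dots> = cscale (- of_real \<sigma>) (nt (pd_rho Y) p ** M p)"
    using natural_inv_cscale[OF natural \<open>p \<in> U\<close>] natural_inv_mult[OF natural \<open>p \<in> U\<close>]
      natural_M[OF \<open>p \<in> U\<close>] natural_inv_scalar[OF natural] by auto
  finally have v: "nt (pd_v W) p = cscale f (nt (pd_rho Y) p ** M p)"
    using sigma by (auto simp: cscale_eq_iff[OF chi_nz] inverse_sc_chi cscale_cscale)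
  show "has_pd_rho (\<lambda>q. nt Y q ** M q) (cscale (- of_real \<sigma> * f) (nt (pd_v Y) p ** M p)) p"
    using natural_inv_has_pd_rho[OF natural W(1) \<open>p \<in> U\<close>] open_U \<open>p \<in> U\<close> nt_W rho
    by (auto intro: has_pd_rho_transform_within_open)
  show "has_pd_v (\<lambda>q. nt Y q ** M q) (cscale f (nt (pd_rho Y) p ** M p)) p"
    using natural_inv_has_pd_v[OF natural W(2) \<open>p \<in> U\<close>] open_U \<open>p \<in> U\<close> nt_W v
    by (auto intro: has_pd_v_transform_within_open)
qed

lemma solves_pairing_hstar_eigen:
  assumes X: "solves f X" and Y: "solves chi Y" and "p \<in> U" "f p \<noteq> 0"
    and chi: "chi p = - of_real \<sigma> / sc (f p)"
  obtains R S where "has_pd_rho (\<lambda>q. nt Y q ** M q ** X q) R p"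
    "has_pd_v (\<lambda>q. nt Y q ** M q ** X q) S p"
    "(cscale (f p) R, cscale (f p) S) = hstar \<sigma> (R, S)"
proof -
  let ?P = "\<lambda>q. nt Y q ** M q ** X q"
  define Z\<rho> Zv where "Z\<rho> = M p ** pd_rho X p + pd_rho M p ** X p"
    and "Zv = M p ** pd_v X p + pd_v M p ** X p"
  define R S where "R = nt Y p ** Z\<rho> + nt (pd_rho Y) p ** (M p ** X p)"
    and "S = nt Y p ** Zv + nt (pd_v Y) p ** (M p ** X p)"
  have Y_pd: "has_pd_rho Y (pd_rho Y q) q" "has_pd_v Y (pd_v Y q) q" if "q \<in> U" for q
    using Y that by (simp_all add: solves_def)
  have X_pd: "has_pd_rho X (pd_rho X p) p" "has_pd_v X (pd_v X p) p"
    using X \<open>p \<in> U\<close> by (simp_all add: solves_def)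
  have P_assoc: "?P = (\<lambda>q. nt Y q ** (M q ** X q))"
    by (simp add: matrix_mul_assoc)
  have rho_via_X: "has_pd_rho ?P R p" and v_via_X: "has_pd_v ?P S p"
    unfolding P_assoc R_def S_def Z\<rho>_def Zv_def
    using solves_M_mult(1,2)[OF X \<open>p \<in> U\<close>] Y_pd \<open>p \<in> U\<close>
    by (auto intro: natural_inv_has_pd_rho_mult[OF natural] natural_inv_has_pd_v_mult[OF natural])
  have rho_via_Y: "has_pd_rho ?P (nt Y p ** M p ** pd_rho X p
      + cscale (- of_real \<sigma> * f p) (nt (pd_v Y) p ** M p) ** X p) p"
    and v_via_Y: "has_pd_v ?P (nt Y p ** M p ** pd_v X p
      + cscale (f p) (nt (pd_rho Y) p ** M p) ** X p) p"
    using solves_natural_mult_M_has_pd[OF Y \<open>p \<in> U\<close> \<open>f p \<noteq> 0\<close> chi] X_pd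
    by (auto intro: has_pd_rho_mult has_pd_v_mult)
  have "cscale (f p) Z\<rho> = M p ** pd_v X p"
    "cscale (f p) Zv = cscale (- of_real \<sigma>) (M p ** pd_rho X p)"
    using solves_M_mult(3,4)[OF X \<open>p \<in> U\<close>] by (simp_all add: Z\<rho>_def Zv_def)
  then have YZ: "cscale (f p) (nt Y p ** Z\<rho>) = nt Y p ** M p ** pd_v X p"
    "cscale (f p) (nt Y p ** Zv) = cscale (- of_real \<sigma>) (nt Y p ** M p ** pd_rho X p)"
    by (simp_all add: matrix_mult_cscale_right[symmetric] matrix_mul_assoc)
  have "cscale (f p) R = S"
    using has_pd_v_imp_pd_v[OF v_via_X] has_pd_v_imp_pd_v[OF v_via_Y]
    by (simp add: R_def cscale_add YZ matrix_mult_cscale_left matrix_mul_assoc)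
  moreover have "cscale (f p) S = cscale (- of_real \<sigma>) R"
    using has_pd_rho_imp_pd_rho[OF rho_via_X] has_pd_rho_imp_pd_rho[OF rho_via_Y] sigma
    by (auto simp: S_def cscale_add YZ matrix_mult_cscale_left matrix_mul_assoc cscale_cscale)
  ultimately show thesis
    using that[OF rho_via_X v_via_X] by (simp add: hstar_def scaleR_eq_cscale)
qed

theorem solves_pairing_has_pd_0:
  assumes "solves f X" "solves chi Y" "p \<in> U" "f p \<noteq> 0" "(f p)\<^sup>2 + of_real \<sigma> \<noteq> 0"
    and "chi p = - of_real \<sigma> / sc (f p)"
  shows "has_pd_rho (\<lambda>q. nt Y q ** M q ** X q) 0 p \<and> has_pd_v (\<lambda>q. nt Y q ** M q ** X q) 0 p"
proof -
  obtain R S where "has_pd_rho (\<lambda>q. nt Y q ** M q ** X q) R p"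
    "has_pd_v (\<lambda>q. nt Y q ** M q ** X q) S p" "(cscale (f p) R, cscale (f p) S) = hstar \<sigma> (R, S)"
    using solves_pairing_hstar_eigen[OF assms(1-4,6)] .
  with hstar_eigenform_eq_0[of "f p" R S \<sigma>] assms(5) show ?thesis
    by auto
qed

end

theorem mainTheorem8:
  fixes \<sigma> :: real and U :: "(real \<times> real) set"
    and sc :: "complex \<Rightarrow> complex"
    and nt :: "(real \<times> real \<Rightarrow> complex^'n::finite^'n) \<Rightarrow> (real \<times> real \<Rightarrow> complex^'n^'n)"
    and V X Xt M :: "real \<times> real \<Rightarrow> complex^'n^'n"
    and A :: "real \<times> real \<Rightarrow> (complex^'n^'n) \<times> (complex^'n^'n)"
    and \<phi> chi :: "real \<times> real \<Rightarrow> complex"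
  assumes sigma: "\<sigma> \<in> {1, -1}"
    and U_open: "open U" and U_half: "U \<subseteq> {p. fst p > 0}"
    and nt: "natural_inv U \<sigma> sc nt"
    and V_C2: "Ck_on 2 U V" and V_inv: "\<forall>p\<in>U. invertible (V p)"
    and M_def: "M = (\<lambda>p. nt V p ** V p)"
    and A_def: "A = (\<lambda>p. (matrix_inv (M p) ** pd_rho M p, matrix_inv (M p) ** pd_v M p))"
    and phi_smooth: "smooth_on U \<phi>" and chi_smooth: "smooth_on U chi"
    and phi_form: "sqrt_branch_form U \<sigma> \<phi>" and chi_form: "sqrt_branch_form U \<sigma> chi"
    and phi_nz: "\<forall>p\<in>U. \<phi> p \<noteq> 0 \<and> (\<phi> p)\<^sup>2 + of_real \<sigma> \<noteq> 0"
    and chi_nz: "\<forall>p\<in>U. chi p \<noteq> 0 \<and> (chi p)\<^sup>2 + of_real \<sigma> \<noteq> 0"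
    and chi_phi: "\<forall>p\<in>U. chi p = - of_real \<sigma> / sc (\<phi> p)"
    and X_C2: "Ck_on 2 U X" and X_inv: "\<forall>p\<in>U. invertible (X p)"
    and X_inv_C1: "Ck_on 1 U (\<lambda>p. matrix_inv (X p))"
    and Xt_C2: "Ck_on 2 U Xt" and Xt_inv: "\<forall>p\<in>U. invertible (Xt p)"
    and Xt_inv_C1: "Ck_on 1 U (\<lambda>p. matrix_inv (Xt p))"
    and X_eq: "\<forall>p\<in>U.
       (cscale (\<phi> p) (fst (dform X p) + fst (A p) ** X p),
        cscale (\<phi> p) (snd (dform X p) + snd (A p) ** X p)) = hstar \<sigma> (dform X p)"
    and Xt_eq: "\<forall>p\<in>U.
       (cscale (chi p) (fst (dform Xt p) + fst (A p) ** Xt p),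
        cscale (chi p) (snd (dform Xt p) + snd (A p) ** Xt p)) = hstar \<sigma> (dform Xt p)"
  shows "\<forall>p\<in>U. has_pd_rho (\<lambda>q. nt Xt q ** M q ** X q) 0 p
              \<and> has_pd_v (\<lambda>q. nt Xt q ** M q ** X q) 0 p"
proof -
  have V: "has_pd_rho V (pd_rho V q) q" "has_pd_v V (pd_v V q) q" if "q \<in> U" for q
    using Ck_on_has_pd[OF V_C2 _ that] by simp_all
  interpret natural_connection U \<sigma> sc nt M A
  proof
    fix q assume "q \<in> U"
    show "invertible (M q)"
      unfolding M_def using natural_inv_invertible[OF nt] V_inv \<open>q \<in> U\<close> by (simp add: invertible_mult)
    show "nt M q = M q"
      unfolding M_def using natural_inv_mult_self[OF nt \<open>q \<in> U\<close>] .
    show "has_pd_rho M (pd_rho M q) q"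
      unfolding M_def
      by (rule has_pd_rho_pd_rho[OF natural_inv_has_pd_rho_mult[OF nt V(1) V(1)[OF \<open>q \<in> U\<close>] \<open>q \<in> U\<close>]])
    show "has_pd_v M (pd_v M q) q"
      unfolding M_def
      by (rule has_pd_v_pd_v[OF natural_inv_has_pd_v_mult[OF nt V(2) V(2)[OF \<open>q \<in> U\<close>] \<open>q \<in> U\<close>]])
  qed (use sigma U_open nt A_def in auto)
  have "solves \<phi> X" "solves chi Xt"
    using Ck_on_has_pd[OF X_C2] Ck_on_has_pd[OF Xt_C2] X_eq Xt_eq by (simp_all add: solves_def)
  then show ?thesis
    using solves_pairing_has_pd_0 phi_nz chi_phi by blast
qed

end
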